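(* Let $a\in\mathbb{R}$, $n\in\mathbb{Z}_+$, $\alpha,\beta>0$, let $w:\mathbb{N}_a\to\mathbb{R}\setminus\{0\}$ satisfy $\frac{w(a)}{w(k)}>0$ for all $k\in\mathbb{N}_{a+1}$, and let $u,v:\mathbb{N}_a\to\mathbb{R}^n$. If $u,v$ are synchronous, then for all $k\in\mathbb{N}_{a+1}$, $${}_a^{\rm G}\nabla_k^{-\alpha,w(k)}[u^{\rm T}(k)v(k)]\;{}_a^{\rm G}\nabla_k^{-\beta,w(k)}1+{}_a^{\rm G}\nabla_k^{-\beta,w(k)}[u^{\rm T}(k)v(k)]\;{}_a^{\rm G}\nabla_k^{-\alpha,w(k)}1$$ $$\ge {}_a^{\rm G}\nabla_k^{-\alpha,w(k)}u^{\rm T}(k)\;{}_a^{\rm G}\nabla_k^{-\beta,w(k)}v(k)+{}_a^{\rm G}\nabla_k^{-\beta,w(k)}u^{\rm T}(k)\;{}_a^{\rm G}\nabla_k^{-\alpha,w(k)}v(k).$$ If $u,v$ are asynchronous, then for all $k\in\mathbb{N}_{a+1}$, $${}_a^{\rm G}\nabla_k^{-\alpha,w(k)}[u^{\rm T}(k)v(k)]\;{}_a^{\rm G}\nabla_k^{-\beta,w(k)}1+{}_a^{\rm G}\nabla_k^{-\beta,w(k)}[u^{\rm T}(k)v(k)]\;{}_a^{\rm G}\nabla_k^{-\alpha,w(k)}1$$ $$\le {}_a^{\rm G}\nabla_k^{-\alpha,w(k)}u^{\rm T}(k)\;{}_a^{\rm G}\nabla_k^{-\beta,w(k)}v(k)+{}_a^{\rm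 G}\nabla_k^{-\beta,w(k)}u^{\rm T}(k)\;{}_a^{\rm G}\nabla_k^{-\alpha,w(k)}v(k).$$ (Juxtaposition denotes the product of the two operator values.)
   Context: For $a\in\mathbb{R}$, $\mathbb{N}_a:=\{a,a+1,a+2,\dots\}$. Functions $u,v:\mathbb{N}_a\to\mathbb{R}^n$ are synchronous (resp. asynchronous) if $[u(j)-u(k)]^{\rm T}[v(j)-v(k)]\ge 0$ (resp. $\le 0$) for all $j,k\in\mathbb{N}_a$. The rising function is $p^{\overline{q}}:=\frac{\Gamma(p+q)}{\Gamma(p)}$. For $\alpha>0$ and $k\in\mathbb{N}_{a+1}$, the Grünwald–Letnikov fractional sum is ${}_a^{\rm G}\nabla_k^{-\alpha}x(k):=\sum_{j=a+1}^{k}\frac{(k-j+1)^{\overline{\alpha-1}}}{\Gamma(\alpha)}x(j)$, and the tempered sum is ${}_a^{\rm G}\nabla_k^{-\alpha,w(k)}x(k):=w^{-1}(k)\,{}_a^{\rm G}\nabla_k^{-\alpha}[w(k)x(k)]=\sum_{j=a+1}^{k}\frac{(k-j+1)^{\overline{\alpha-1}}}{\Gamma(\alpha)}\frac{w(j)}{w(k)}x(j)$. It acts componentwise on vector-valued sequences; ${}_a^{\rm G}\nabla_k^{-\alpha,w(k)}1$ is the operator applied to the constant sequence $1$. *)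

theory Defs
  imports "HOL-Analysis.Analysis"
begin

definition nat_shift :: "real \<Rightarrow> real set" where
  "nat_shift a = {a + real m | m. True}"

(* Functions on nat_shift a are rendered as total functions on real, of which only the
   values on nat_shift a are ever constrained or used. *)

definition synchronous :: "real \<Rightarrow> (real \<Rightarrow> real ^ 'n) \<Rightarrow> (real \<Rightarrow> real ^ 'n) \<Rightarrow> bool" where
  "synchronous a u v \<longleftrightarrow>
     (\<forall>j\<in>nat_shift a. \<forall>k\<in>nat_shift a. (u j - u k) \<bullet> (v j - v k) \<ge> 0)"

definition asynchronous :: "real \<Rightarrow> (real \<Rightarrow> real ^ 'n) \<Rightarrow> (real \<Rightarrow> real ^ 'n) \<Rightarrow> bool" where
  "asynchronous a u v \<longleftrightarrow>
     (\<forall>j\<in>nat_shift a. \<forall>k\<in>nat_shift a. (u j - u k) \<bullet> (v j - v k) \<le> 0)"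

definition rising :: "real \<Rightarrow> real \<Rightarrow> real" where
  "rising p q = Gamma (p + q) / Gamma p"

(* The sum over j = a+1, ..., k.  One definition serves scalar and vector sequences:
   scaleR is multiplication on real and acts componentwise on real ^ 'n. *)
definition gl_sum :: "real \<Rightarrow> real \<Rightarrow> (real \<Rightarrow> 'b::real_vector) \<Rightarrow> real \<Rightarrow> 'b" where
  "gl_sum a \<alpha> x k =
     (\<Sum>j\<in>{j \<in> nat_shift (a + 1). j \<le> k}. (rising (k - j + 1) (\<alpha> - 1) / Gamma \<alpha>) *\<^sub>R x j)"

definition tempered_sum ::
    "real \<Rightarrow> real \<Rightarrow> (real \<Rightarrow> real) \<Rightarrow> (real \<Rightarrow> 'b::real_vector) \<Rightarrow> real \<Rightarrow> 'b" where
  "tempered_sum a \<alpha> w x k = inverse (w k) *\<^sub>R gl_sum a \<alpha> (\<lambda>j. w j *\<^sub>R x j) k"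

lemma index_set_eq:
  "{j \<in> nat_shift (a + 1). j \<le> a + real m} = (\<lambda>i. a + real i) ` {1..m}"
proof (intro equalityI subsetI)
  fix j assume "j \<in> {j \<in> nat_shift (a + 1). j \<le> a + real m}"
  then obtain i where i: "j = a + 1 + real i" "j \<le> a + real m"
    by (auto simp: nat_shift_def)
  then have "j = a + real (Suc i)" "Suc i \<in> {1..m}" by auto
  then show "j \<in> (\<lambda>i. a + real i) ` {1..m}" by blast
next
  fix j assume "j \<in> (\<lambda>i. a + real i) ` {1..m}"
  then obtain i where i: "j = a + real i" "1 \<le> i" "i \<le> m" by auto
  then have "j = a + 1 + real (i - 1)" by (simp add: of_nat_diff)
  then have "j \<in> nat_shift (a + 1)" unfolding nat_shift_def by blast
  with i show "j \<in> {j \<in> nat_shift (a + 1). j \<le> a + real m}" by simp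
qed

lemma tempered_sum_eq:
  fixes x :: "real \<Rightarrow> real"
  shows "tempered_sum a \<alpha> w x k =
    (\<Sum>j\<in>{j \<in> nat_shift (a + 1). j \<le> k}.
       rising (k - j + 1) (\<alpha> - 1) / Gamma \<alpha> * (w j / w k) * x j)"
  by (simp add: tempered_sum_def gl_sum_def sum_distrib_left divide_inverse mult_ac)

lemma tempered_sum_component:
  fixes x :: "real \<Rightarrow> real ^ 'n"
  shows "tempered_sum a \<alpha> w x k $ i = tempered_sum a \<alpha> w (\<lambda>j. x j $ i) k"
  by (simp add: tempered_sum_def gl_sum_def mult.assoc)

end

theory Submission
  imports Defs
begin

text \<open>
  At a fixed \<^term>\<open>k\<close> the two tempered sums are finite linear combinations of the values of a
  sequence, with weights \<^term>\<open>p j\<close> (of order \<open>\<alpha>\<close>) and \<^term>\<open>q j\<close> (of order \<open>\<beta>\<close>).  As in the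
  double-sum proof of Chebyshev's inequality for two measures, expanding
  \<open>\<Sum>i j. p i * q j * ((u i - u j) \<bullet> (v i - v j))\<close> gives exactly the difference of the two sides of the
  claim (\<open>chebyshev_double_sum\<close>).  All weights are nonnegative: the Gamma values occurring in the
  rising functions have positive arguments, and \<open>w\<close> has a constant sign on the summation range, so
  \<open>w j / w k > 0\<close> (\<open>tempered_weight_nonneg\<close>).  Hence that difference has the sign which the
  (a)synchrony hypothesis gives to each inner product.
\<close>

text \<open>
  The diagonal products \<open>u i \<bullet> v i\<close> and \<open>u j \<bullet> v j\<close> of the expanded inner product leave one free
  index, whose weights add up to a total mass; the cross products factor by bilinearity.
\<close>

lemma chebyshev_double_sum:
  fixes p q :: "'i \<Rightarrow> real" and u v :: "'i \<Rightarrow> 'b::real_inner"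
  shows "(\<Sum>i\<in>S. \<Sum>j\<in>S. p i * q j * ((u i - u j) \<bullet> (v i - v j))) =
      (\<Sum>i\<in>S. p i * (u i \<bullet> v i)) * (\<Sum>j\<in>S. q j) + (\<Sum>j\<in>S. q j * (u j \<bullet> v j)) * (\<Sum>i\<in>S. p i)
      - ((\<Sum>i\<in>S. p i *\<^sub>R u i) \<bullet> (\<Sum>j\<in>S. q j *\<^sub>R v j)
         + (\<Sum>j\<in>S. q j *\<^sub>R u j) \<bullet> (\<Sum>i\<in>S. p i *\<^sub>R v i))"
proof -
  have diag_p: "(\<Sum>i\<in>S. p i * (u i \<bullet> v i)) * (\<Sum>j\<in>S. q j) =
      (\<Sum>i\<in>S. \<Sum>j\<in>S. p i * q j * (u i \<bullet> v i))"
    unfolding sum_product by (simp add: mult_ac)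
  have diag_q: "(\<Sum>j\<in>S. q j * (u j \<bullet> v j)) * (\<Sum>i\<in>S. p i) =
      (\<Sum>i\<in>S. \<Sum>j\<in>S. p i * q j * (u j \<bullet> v j))"
    by (subst mult.commute, unfold sum_product) (simp add: mult_ac)
  have cross_pq: "(\<Sum>i\<in>S. p i *\<^sub>R u i) \<bullet> (\<Sum>j\<in>S. q j *\<^sub>R v j) =
      (\<Sum>i\<in>S. \<Sum>j\<in>S. p i * q j * (u i \<bullet> v j))"
    unfolding inner_sum_left by (simp add: inner_sum_right mult_ac)
  have cross_qp: "(\<Sum>j\<in>S. q j *\<^sub>R u j) \<bullet> (\<Sum>i\<in>S. p i *\<^sub>R v i) =
      (\<Sum>i\<in>S. \<Sum>j\<in>S. p i * q j * (u j \<bullet> v i))"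
    by (subst inner_commute, unfold inner_sum_left)
      (simp add: inner_sum_right mult_ac inner_commute)
  show ?thesis
    unfolding diag_p diag_q cross_pq cross_qp
    by (simp add: inner_diff_left inner_diff_right algebra_simps sum.distrib sum_subtractf)
qed

definition tempered_weight :: "real \<Rightarrow> (real \<Rightarrow> real) \<Rightarrow> real \<Rightarrow> real \<Rightarrow> real" where
  "tempered_weight \<alpha> w k j = rising (k - j + 1) (\<alpha> - 1) / Gamma \<alpha> * (w j / w k)"

lemma tempered_sum_weights:
  "tempered_sum a \<alpha> w x k =
     (\<Sum>j\<in>{j \<in> nat_shift (a + 1). j \<le> k}. tempered_weight \<alpha> w k j *\<^sub>R x j)"
  by (simp add: tempered_sum_def gl_sum_def tempered_weight_def scaleR_right.sum
      divide_inverse mult_ac)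

text \<open>
  The reference point \<^term>\<open>b\<close> only serves to say that \<^term>\<open>w j\<close> and \<^term>\<open>w k\<close> have the same
  sign.  The bound \<open>j \<le> k\<close> keeps both Gamma arguments \<open>k - j + \<alpha>\<close> and \<open>k - j + 1\<close> positive.
\<close>

lemma tempered_weight_nonneg:
  assumes "\<alpha> > 0" "j \<le> k" "w b / w j > 0" "w b / w k > 0"
  shows "tempered_weight \<alpha> w k j \<ge> 0"
proof -
  have "Gamma (k - j + \<alpha>) > 0" "Gamma (k - j + 1) > 0" "Gamma \<alpha> > 0"
    using assms(1,2) by (auto intro!: Gamma_real_pos)
  moreover have "w j / w k \<ge> 0"
    using assms(3,4) by (auto simp: zero_less_divide_iff zero_le_divide_iff)
  ultimately show ?thesis
    unfolding tempered_weight_def rising_def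
    by (intro mult_nonneg_nonneg[OF divide_nonneg_nonneg[OF divide_nonneg_nonneg]])
      (auto simp: algebra_simps)
qed

lemma nat_shift_Suc_subset: "nat_shift (a + 1) \<subseteq> nat_shift a"
proof
  fix x assume "x \<in> nat_shift (a + 1)"
  then obtain m where "x = a + 1 + real m"
    by (auto simp: nat_shift_def)
  then have "x = a + real (Suc m)"
    by simp
  then show "x \<in> nat_shift a"
    unfolding nat_shift_def by blast
qed

theorem theorem3p13:
  fixes a \<alpha> \<beta> :: real
    and w :: "real \<Rightarrow> real"
    and u v :: "real \<Rightarrow> real ^ 'n"
  assumes "\<alpha> > 0" and "\<beta> > 0"
    and "\<forall>k\<in>nat_shift a. w k \<noteq> 0"
    and "\<forall>k\<in>nat_shift (a + 1). w a / w k > 0"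
  shows "(synchronous a u v \<longrightarrow>
           (\<forall>k\<in>nat_shift (a + 1).
              tempered_sum a \<alpha> w (\<lambda>j. u j \<bullet> v j) k * tempered_sum a \<beta> w (\<lambda>j. 1::real) k
            + tempered_sum a \<beta> w (\<lambda>j. u j \<bullet> v j) k * tempered_sum a \<alpha> w (\<lambda>j. 1::real) k
            \<ge> tempered_sum a \<alpha> w u k \<bullet> tempered_sum a \<beta> w v k
            + tempered_sum a \<beta> w u k \<bullet> tempered_sum a \<alpha> w v k))
       \<and> (asynchronous a u v \<longrightarrow>
           (\<forall>k\<in>nat_shift (a + 1).
              tempered_sum a \<alpha> w (\<lambda>j. u j \<bullet> v j) k * tempered_sum a \<beta> w (\<lambda>j. 1::real) k
            + tempered_sum a \<beta> w (\<lambda>j. u j \<bullet> v j) k * tempered_sum a \<alpha> w (\<lambda>j. 1::real) k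
            \<le> tempered_sum a \<alpha> w u k \<bullet> tempered_sum a \<beta> w v k
            + tempered_sum a \<beta> w u k \<bullet> tempered_sum a \<alpha> w v k))"
proof -
  let ?S = "\<lambda>k. {j \<in> nat_shift (a + 1). j \<le> k}"
  let ?p = "tempered_weight \<alpha> w" and ?q = "tempered_weight \<beta> w"
  have defect:
    "tempered_sum a \<alpha> w (\<lambda>j. u j \<bullet> v j) k * tempered_sum a \<beta> w (\<lambda>j. 1::real) k
     + tempered_sum a \<beta> w (\<lambda>j. u j \<bullet> v j) k * tempered_sum a \<alpha> w (\<lambda>j. 1::real) k
     - (tempered_sum a \<alpha> w u k \<bullet> tempered_sum a \<beta> w v k
        + tempered_sum a \<beta> w u k \<bullet> tempered_sum a \<alpha> w v k)
     = (\<Sum>i\<in>?S k. \<Sum>j\<in>?S k. ?p k i * ?q k j * ((u i - u j) \<bullet> (v i - v j)))" for k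
    by (simp add: tempered_sum_weights chebyshev_double_sum)
  have weights: "?p k i * ?q k j \<ge> 0"
    if "k \<in> nat_shift (a + 1)" "i \<in> ?S k" "j \<in> ?S k" for k i j
    using that assms by (auto intro!: mult_nonneg_nonneg tempered_weight_nonneg[where b = a])
  have in_domain: "j \<in> nat_shift a" if "j \<in> ?S k" for j k
    using that nat_shift_Suc_subset by auto
  have "(\<Sum>i\<in>?S k. \<Sum>j\<in>?S k. ?p k i * ?q k j * ((u i - u j) \<bullet> (v i - v j))) \<ge> 0"
    if "synchronous a u v" "k \<in> nat_shift (a + 1)" for k
    using that in_domain[of _ k]
    by (intro sum_nonneg mult_nonneg_nonneg[OF weights]) (auto simp: synchronous_def)
  moreover have "(\<Sum>i\<in>?S k. \<Sum>j\<in>?S k. ?p k i * ?q k j * ((u i - u j) \<bullet> (v i - v j))) \<le> 0"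
    if "asynchronous a u v" "k \<in> nat_shift (a + 1)" for k
    using that in_domain[of _ k]
    by (intro sum_nonpos mult_nonneg_nonpos[OF weights]) (auto simp: asynchronous_def)
  ultimately show ?thesis
    by (simp flip: defect)
qed

end
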